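(* Let $X$ be a nonempty set. (1) Suppose $X$ is infinite. Then the semigroups $B(G;M_i;\pi_i)_{i\in I}$, where $G$ is a minimal transitive subgroup of $\mathcal{S}(M_1)$, constitute the full list of minimal transitive subsemigroups of $\mathcal{IS}_{fin}(X)$; that is, a subsemigroup of $\mathcal{IS}_{fin}(X)$ is a minimal transitive subsemigroup if and only if it equals some $B(G;M_i;\pi_i)_{i\in I}$ with $G$ a minimal transitive subgroup of $\mathcal{S}(M_1)$. (2) Suppose $X$ is finite, $|X|=n$. Then the semigroups $B(G;M_i;\pi_i)_{i\in I}$, where $|I|>1$ and $G$ is a minimal transitive subgroup of $\mathcal{S}(M_1)$, together with all minimal transitive subgroups of $\mathcal{S}(X)$, constitute the full list of minimal transitive subsemigroups of $\mathcal{IS}(X)$; that is, a subsemigroup of $\mathcal{IS}(X)$ is a minimal transitive subsemigroup if and only if it is one of these.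
   Context: $\mathcal{IS}(X)$ is the full inverse symmetric semigroup on $X$: all partial one-to-one transformations (partial injective maps) of $X$, including the nowhere defined one $0$, with maps written on the right and composed from left to right. The rank of an element is the cardinality of its range; $\mathcal{IS}_{fin}(X)$ is the subsemigroup of all elements of finite rank (equal to $\mathcal{IS}(X)$ if $X$ is finite). $\mathcal{S}(M)$ is the symmetric group of a set $M$. For $M\subseteq X$, an element of $\mathcal{S}(M)$ is regarded as the element of $\mathcal{IS}(X)$ with domain and range $M$. A subsemigroup $S$ of $\mathcal{IS}(X)$ is transitive if for every $(x,y)\in X\times X$ there is $\varphi\in S$ with $x\varphi=y$. A minimal transitive subsemigroup is a transitive subsemigroup that properly contains no transitive subsemigroup. A minimal transitive subgroup of $\mathcal{S}(M)$ is a subgroup acting transitively on $M$ that properly contains no subgroup acting transitively on $M$. Definition of $B(G;M_i;\pi_i)_{i\in I}$: let $I$ be an index set with $|I|>1$ and with a distinguished element $1\in I$; let $\{M_i: i\in I\}$ be pairwise disjoint subsets of $X$ with $X=\bigcup_{i\in I}M_i$, all of the same finite cardinality; let $G$ be a subgroup of $\mathcal{S}(M_1)$; and for every $i\in I$ let $\pi_i$ be a bijection from $M_1$ to $M_i$. For $i,j\in I$, $g\in G$ put $M(i,g,j)=\pi_i^{-1}g\pi_j$ (a bijection from $M_i$ to $M_j$, viewed as an element of $\mathcal{IS}(X)$). Then $B(G;M_i;\pi_i)_{i\in I}=\{M(i,g,j): i,j\in I,\ g\in G\}\cup\{0\}$. *)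

theory Defs
  imports "HOL-Algebra.Group_Action" "HOL-Library.Disjoint_Sets"
begin

text \<open>Partial maps are of type \<open>'a \<rightharpoonup> 'a\<close>; the nowhere defined map \<open>0\<close> is \<^const>\<open>Map.empty\<close>.
  Maps are composed from left to right, so the product \<open>f g\<close> is \<open>g \<circ>\<^sub>m f\<close>.\<close>

definition IS :: "'a set \<Rightarrow> ('a \<rightharpoonup> 'a) set" where
  "IS X = {f. dom f \<subseteq> X \<and> ran f \<subseteq> X \<and> inj_on f (dom f)}"

definition IS_fin :: "'a set \<Rightarrow> ('a \<rightharpoonup> 'a) set" where
  \<comment> \<open>the rank of \<open>f\<close> is the cardinality of its range\<close>
  "IS_fin X = {f \<in> IS X. finite (ran f)}"

definition subsemigroup :: "('a \<rightharpoonup> 'a) set \<Rightarrow> ('a \<rightharpoonup> 'a) set \<Rightarrow> bool" where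
  "subsemigroup S T \<longleftrightarrow> S \<noteq> {} \<and> S \<subseteq> T \<and> (\<forall>f\<in>S. \<forall>g\<in>S. g \<circ>\<^sub>m f \<in> S)"

definition transitive_on :: "'a set \<Rightarrow> ('a \<rightharpoonup> 'a) set \<Rightarrow> bool" where
  "transitive_on X S \<longleftrightarrow> (\<forall>x\<in>X. \<forall>y\<in>X. \<exists>f\<in>S. f x = Some y)"

definition minimal_transitive_subsemigroup ::
    "'a set \<Rightarrow> ('a \<rightharpoonup> 'a) set \<Rightarrow> ('a \<rightharpoonup> 'a) set \<Rightarrow> bool" where
  "minimal_transitive_subsemigroup X T S \<longleftrightarrow>
     subsemigroup S T \<and> transitive_on X S \<and>
     (\<forall>S'. subsemigroup S' T \<and> transitive_on X S' \<longrightarrow> \<not> S' \<subset> S)"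

text \<open>The symmetric group of \<open>M\<close> is \<^term>\<open>BijGroup M\<close>. It composes from right to left, but a
  group and its opposite have the same subgroups.\<close>

definition transitive_subgroup :: "'a set \<Rightarrow> ('a \<Rightarrow> 'a) set \<Rightarrow> bool" where
  "transitive_subgroup M G \<longleftrightarrow>
     subgroup G (BijGroup M) \<and> transitive_action (BijGroup M\<lparr>carrier := G\<rparr>) M (\<lambda>g. g)"

definition minimal_transitive_subgroup :: "'a set \<Rightarrow> ('a \<Rightarrow> 'a) set \<Rightarrow> bool" where
  "minimal_transitive_subgroup M G \<longleftrightarrow>
     transitive_subgroup M G \<and> (\<forall>H. transitive_subgroup M H \<longrightarrow> \<not> H \<subset> G)"

text \<open>The partial map with domain \<open>A\<close> that agrees with \<open>f\<close> on \<open>A\<close>. In particular, a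
  permutation \<open>g\<close> of \<open>M\<close>, regarded as a partial map, is \<open>as_partial M g\<close>.\<close>

definition as_partial :: "'a set \<Rightarrow> ('a \<Rightarrow> 'a) \<Rightarrow> ('a \<rightharpoonup> 'a)" where
  "as_partial A f = (\<lambda>x. if x \<in> A then Some (f x) else None)"

text \<open>The index \<open>e\<close> is the distinguished element of \<open>I\<close>, written \<open>1\<close> in the notation
  \<open>M\<^sub>1\<close>.\<close>

definition B_data ::
    "'a set \<Rightarrow> 'i set \<Rightarrow> 'i \<Rightarrow> ('a \<Rightarrow> 'a) set \<Rightarrow> ('i \<Rightarrow> 'a set) \<Rightarrow> ('i \<Rightarrow> 'a \<Rightarrow> 'a) \<Rightarrow> bool" where
  "B_data X I e G M \<pi> \<longleftrightarrow>
     e \<in> I \<and> (\<exists>i\<in>I. \<exists>j\<in>I. i \<noteq> j) \<and>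
     disjoint_family_on M I \<and> X = (\<Union>i\<in>I. M i) \<and>
     (\<forall>i\<in>I. finite (M i)) \<and> (\<forall>i\<in>I. \<forall>j\<in>I. card (M i) = card (M j)) \<and>
     subgroup G (BijGroup (M e)) \<and> (\<forall>i\<in>I. bij_betw (\<pi> i) (M e) (M i))"

text \<open>\<open>B_map e M \<pi> i g j\<close> is the element \<open>M(i,g,j) = \<pi>\<^sub>i\<^sup>-\<^sup>1 g \<pi>\<^sub>j\<close>, maps being composed from
  left to right.\<close>

definition B_map ::
    "'i \<Rightarrow> ('i \<Rightarrow> 'a set) \<Rightarrow> ('i \<Rightarrow> 'a \<Rightarrow> 'a) \<Rightarrow> 'i \<Rightarrow> ('a \<Rightarrow> 'a) \<Rightarrow> 'i \<Rightarrow> ('a \<rightharpoonup> 'a)" where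
  "B_map e M \<pi> i g j = as_partial (M i) (\<pi> j \<circ> g \<circ> inv_into (M e) (\<pi> i))"

definition B ::
    "'i set \<Rightarrow> 'i \<Rightarrow> ('a \<Rightarrow> 'a) set \<Rightarrow> ('i \<Rightarrow> 'a set) \<Rightarrow> ('i \<Rightarrow> 'a \<Rightarrow> 'a) \<Rightarrow> ('a \<rightharpoonup> 'a) set" where
  "B I e G M \<pi> = {B_map e M \<pi> i g j | i g j. i \<in> I \<and> g \<in> G \<and> j \<in> I} \<union> {Map.empty}"

end

theory Submission
  imports Defs
begin

text \<open>For finite \<open>X\<close> the sets \<^term>\<open>IS X\<close> and \<^term>\<open>IS_fin X\<close> coincide, so everything is proved
  for semigroups of partial injections of finite rank.

  Let \<open>S\<close> be a minimal transitive subsemigroup. The elements of \<open>S\<close> whose rank is at most the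
  least nonzero rank form an ideal that is again transitive, so by minimality they are all
  of \<open>S\<close>: every nonzero element has the same rank \<open>k\<close> (\<open>minimal_imp_constant_rank\<close>). If the range
  of \<open>f\<close> meets the domain of \<open>g\<close>, then the product of \<open>f\<close> and \<open>g\<close> is nonzero, hence of rank \<open>k\<close>,
  which forces that range and that domain to be equal. Thus domains and ranges of nonzero
  elements form one partition of \<open>X\<close> into blocks with \<open>k\<close> elements
  (\<open>minimal_imp_block_system\<close>). The elements of \<open>S\<close> that permute a given block are closed under
  composition and finite in number, hence form a group; from this \<open>S\<close> contains the inverse of
  each of its nonzero elements (\<open>inverse_in_S\<close>).

  If there is only one block, it is \<open>X\<close>, and minimality makes \<open>S\<close> the group of permutations of
  \<open>X\<close> that it contains (\<open>minimal_imp_group\<close>); in particular \<open>X\<close> is finite. If there are more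
  blocks, let \<open>G\<close> be the group of permutations of a block \<open>M\<^sub>e\<close> in \<open>S\<close> and choose in \<open>S\<close> a
  bijection \<open>\<pi>\<^sub>i\<close> of \<open>M\<^sub>e\<close> onto each block \<open>M\<^sub>i\<close>. Multiplying by the \<open>\<pi>\<^sub>i\<close> and their inverses
  gives \<open>S = B(G; M\<^sub>i; \<pi>\<^sub>i)\<close>, and \<open>G\<close> is minimal because a smaller transitive group would give
  a smaller semigroup \<open>B\<close> (\<open>minimal_imp_B\<close>).

  The converse directions are \<open>minimal_B\<close> and \<open>minimal_group\<close>: the permutations found in a
  transitive subsemigroup form a transitive subgroup, which is the whole of the given minimal
  group.\<close>

section \<open>Transitive permutation groups\<close>

lemma (in group) finite_closed_imp_subgroup:
  assumes "finite K" "K \<noteq> {}" "K \<subseteq> carrier G"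
    and closed: "\<And>x y. x \<in> K \<Longrightarrow> y \<in> K \<Longrightarrow> x \<otimes> y \<in> K"
  shows "subgroup K G"
proof -
  \<comment> \<open>Right multiplication by an element of \<open>K\<close> is injective on the finite set \<open>K\<close>, hence onto,
    which yields the unit and the inverses.\<close>
  have surj: "(\<lambda>y. y \<otimes> x) ` K = K" if "x \<in> K" for x
  proof (rule endo_inj_surj)
    show "inj_on (\<lambda>y. y \<otimes> x) K"
      using that assms(3) by (auto intro!: inj_onI simp: subset_iff)
  qed (use that assms in auto)
  obtain x where x: "x \<in> K"
    using assms(2) by auto
  then have "x \<in> (\<lambda>y. y \<otimes> x) ` K"
    by (simp only: surj)
  then obtain y where y: "y \<in> K" "y \<otimes> x = x"
    by force
  then have "y = \<one>"
    using x assms(3) by (metis l_one one_closed right_cancel subsetD)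
  then have one: "\<one> \<in> K"
    using y by simp
  show ?thesis
  proof (rule subgroupI)
    fix a assume a: "a \<in> K"
    then have "\<one> \<in> (\<lambda>y. y \<otimes> a) ` K"
      using one by (simp only: surj)
    then obtain b where "b \<in> K" "b \<otimes> a = \<one>"
      by force
    then show "inv a \<in> K"
      using a assms(3) by (metis inv_equality subsetD)
  qed (use assms in auto)
qed

lemma finite_Bij:
  assumes "finite M"
  shows "finite (Bij M)"
proof (rule finite_subset)
  show "Bij M \<subseteq> M \<rightarrow>\<^sub>E M"
    by (auto simp: Bij_def bij_betw_def PiE_def)
  show "finite (M \<rightarrow>\<^sub>E M)"
    using assms by (rule finite_PiE) (use assms in auto)
qed

lemma subgroup_BijGroupI:
  assumes "finite M" "K \<noteq> {}" "K \<subseteq> Bij M"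
    and closed: "\<And>u v. u \<in> K \<Longrightarrow> v \<in> K \<Longrightarrow> compose M u v \<in> K"
  shows "subgroup K (BijGroup M)"
proof (rule group.finite_closed_imp_subgroup[OF group_BijGroup])
  show "finite K"
    using assms finite_Bij finite_subset by blast
  show "K \<subseteq> carrier (BijGroup M)"
    using assms(3) by (simp add: BijGroup_def)
  show "u \<otimes>\<^bsub>BijGroup M\<^esub> v \<in> K" if "u \<in> K" "v \<in> K" for u v
    using that assms(3) closed by (simp add: BijGroup_def subset_iff)
qed (fact assms)

lemma subgroup_BijGroupD:
  assumes "subgroup K (BijGroup M)"
  shows "K \<subseteq> Bij M"
    and "restrict id M \<in> K"
    and "u \<in> K \<Longrightarrow> v \<in> K \<Longrightarrow> compose M u v \<in> K"
    and "u \<in> K \<Longrightarrow> restrict (inv_into M u) M \<in> K"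
proof -
  show sub: "K \<subseteq> Bij M"
    using subgroup.subset[OF assms] by (simp add: BijGroup_def)
  show "restrict id M \<in> K"
    using subgroup.one_closed[OF assms] by (simp add: BijGroup_def id_def)
  show "compose M u v \<in> K" if "u \<in> K" "v \<in> K"
    using subgroup.m_closed[OF assms that] that sub by (simp add: BijGroup_def subset_iff)
  show "restrict (inv_into M u) M \<in> K" if "u \<in> K"
    using subgroup.m_inv_closed[OF assms that] that sub by (simp add: inv_BijGroup subset_iff)
qed

lemma transitive_subgroup_iff:
  "transitive_subgroup M G \<longleftrightarrow>
     subgroup G (BijGroup M) \<and> (\<forall>x\<in>M. \<forall>y\<in>M. \<exists>g\<in>G. g x = y)"
proof -
  have "group_hom (BijGroup M\<lparr>carrier := G\<rparr>) (BijGroup M) (\<lambda>g. g)"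
    if "subgroup G (BijGroup M)"
  proof (intro group_hom.intro group_hom_axioms.intro)
    show "group (BijGroup M\<lparr>carrier := G\<rparr>)"
      using that group_BijGroup by (rule subgroup.subgroup_is_group)
    show "(\<lambda>g. g) \<in> hom (BijGroup M\<lparr>carrier := G\<rparr>) (BijGroup M)"
      using subgroup.subset[OF that] by (auto simp: hom_def)
  qed (rule group_BijGroup)
  then show ?thesis
    by (auto simp: transitive_subgroup_def transitive_action_def transitive_action_axioms_def
        group_action_def)
qed

lemma Bij_mapsto: "u \<in> Bij M \<Longrightarrow> x \<in> M \<Longrightarrow> u x \<in> M"
  using Bij_imp_funcset by fastforce

lemma Bij_inv_into_f: "u \<in> Bij M \<Longrightarrow> x \<in> M \<Longrightarrow> inv_into M u (u x) = x"
  by (simp add: Bij_def bij_betw_def)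

lemma Bij_f_inv_into: "u \<in> Bij M \<Longrightarrow> x \<in> M \<Longrightarrow> u (inv_into M u x) = x"
  by (simp add: Bij_def bij_betw_def f_inv_into_f)

section \<open>Partial maps\<close>

lemma dom_as_partial [simp]: "dom (as_partial A f) = A"
  by (auto simp: as_partial_def dom_def)

lemma ran_as_partial [simp]: "ran (as_partial A f) = f ` A"
  by (auto simp: as_partial_def ran_def)

lemma as_partial_apply [simp]: "x \<in> A \<Longrightarrow> as_partial A f x = Some (f x)"
  by (simp add: as_partial_def)

lemma as_partial_compose:
  assumes "u \<in> A \<rightarrow> A"
  shows "as_partial A v \<circ>\<^sub>m as_partial A u = as_partial A (compose A v u)"
  using assms by (auto simp: as_partial_def map_comp_def compose_def fun_eq_iff)

lemma as_partial_inject: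
  assumes "as_partial A u = as_partial A v" "u \<in> extensional A" "v \<in> extensional A"
  shows "u = v"
proof (rule extensionalityI[OF assms(2,3)])
  fix x assume "x \<in> A"
  then show "u x = v x"
    using fun_cong[OF assms(1), of x] by simp
qed

lemma ran_empty_imp:
  assumes "ran f = {}"
  shows "f = Map.empty"
proof
  fix x show "f x = None"
    using assms ranI[of f x] by (cases "f x") auto
qed

lemma image_the_dom: "(\<lambda>x. the (f x)) ` dom f = ran f"
  by (force simp: ran_def)

lemma ran_map_comp_eq: "ran (g \<circ>\<^sub>m f) = (\<lambda>y. the (g y)) ` (ran f \<inter> dom g)"
  by (force simp: ran_def map_comp_Some_iff)

lemma IS_fin_bij:
  assumes "f \<in> IS_fin X"
  shows "bij_betw (\<lambda>x. the (f x)) (dom f) (ran f)"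
  using assms image_the_dom[of f]
  by (auto simp: IS_fin_def IS_def bij_betw_def inj_on_def dom_def)

lemma IS_finD:
  assumes "f \<in> IS_fin X"
  shows "dom f \<subseteq> X" "ran f \<subseteq> X" "finite (ran f)" "finite (dom f)" "card (dom f) = card (ran f)"
  using assms IS_fin_bij[OF assms] bij_betw_finite bij_betw_same_card
  by (auto simp: IS_fin_def IS_def)

lemma IS_fin_eq_IS:
  assumes "finite X"
  shows "IS_fin X = IS X"
  using assms by (auto simp: IS_fin_def IS_def intro: finite_subset)

lemma as_partial_in_IS_fin:
  assumes "finite A" "A \<subseteq> X" "f ` A \<subseteq> X" "inj_on f A"
  shows "as_partial A f \<in> IS_fin X"
  using assms by (auto simp: IS_fin_def IS_def inj_on_def)

lemma subsemigroupD:
  assumes "subsemigroup S T"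
  shows "S \<noteq> {}" "S \<subseteq> T" "f \<in> S \<Longrightarrow> g \<in> S \<Longrightarrow> g \<circ>\<^sub>m f \<in> S"
  using assms by (auto simp: subsemigroup_def)

lemma minimal_transitive_subsemigroupD:
  assumes "minimal_transitive_subsemigroup X T S"
    and "S' \<subseteq> S" "S' \<noteq> {}" "transitive_on X S'"
    and closed: "\<And>f g. f \<in> S' \<Longrightarrow> g \<in> S' \<Longrightarrow> g \<circ>\<^sub>m f \<in> S'"
  shows "S' = S"
proof -
  have "S \<subseteq> T"
    using assms(1) by (simp add: minimal_transitive_subsemigroup_def subsemigroup_def)
  then have "subsemigroup S' T"
    using assms(2,3) closed by (auto simp: subsemigroup_def)
  then have "\<not> S' \<subset> S"
    using assms(1,4) by (simp add: minimal_transitive_subsemigroup_def)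
  then show ?thesis
    using assms(2) by blast
qed

text \<open>The permutations of \<open>M\<close> that belong to \<open>S\<close>, as total functions in the encoding of
  \<^const>\<open>Bij\<close>.\<close>

definition perms_in :: "('a \<rightharpoonup> 'a) set \<Rightarrow> 'a set \<Rightarrow> ('a \<Rightarrow> 'a) set" where
  "perms_in S M = {u \<in> Bij M. as_partial M u \<in> S}"

lemma subgroup_perms_in:
  assumes S: "subsemigroup S T" and "finite M" "perms_in S M \<noteq> {}"
  shows "subgroup (perms_in S M) (BijGroup M)"
proof (rule subgroup_BijGroupI)
  fix u v assume uv: "u \<in> perms_in S M" "v \<in> perms_in S M"
  then have "as_partial M u \<circ>\<^sub>m as_partial M v = as_partial M (compose M u v)"
    by (intro as_partial_compose) (simp add: perms_in_def Bij_imp_funcset)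
  then show "compose M u v \<in> perms_in S M"
    using uv subsemigroupD(3)[OF S] by (metis (mono_tags, lifting) compose_Bij mem_Collect_eq perms_in_def)
qed (use assms in \<open>auto simp: perms_in_def\<close>)

lemma perm_of_partial:
  assumes f: "f \<in> IS_fin X" and dr: "dom f = M" "ran f = M"
  obtains u where "u \<in> Bij M" "f = as_partial M u"
proof
  let ?u = "\<lambda>x\<in>M. the (f x)"
  have "bij_betw (\<lambda>x. the (f x)) M M"
    using IS_fin_bij[OF f] dr by simp
  then show "?u \<in> Bij M"
    by (simp add: Bij_def)
  show "f = as_partial M ?u"
    using dr(1) by (auto simp: as_partial_def fun_eq_iff)
qed

section \<open>The semigroups B(G; M, \<pi>)\<close>

lemma dom_B_map [simp]: "dom (B_map e M \<pi> i g j) = M i"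
  by (simp add: B_map_def)

text \<open>The elements of the semigroup are handled through the equation
  \<open>(\<pi>\<^sub>i x) M(i,g,j) = \<pi>\<^sub>j (g x)\<close> for \<open>x \<in> M\<^sub>e\<close> (\<open>B_map_apply\<close>), which together with the domain
  determines them (\<open>B_map_eqI\<close>). Group elements compose from right to left, so that
  \<open>M(i,g,j)\<close> followed by \<open>M(j,h,k)\<close> has the middle entry \<^term>\<open>compose (M e) h g\<close>.\<close>

context
  fixes X :: "'a set" and I :: "'i set" and e and G and M and \<pi>
  assumes data: "B_data X I e G M \<pi>" and X_nonempty: "X \<noteq> {}"
begin

lemma e_in: "e \<in> I"
  and M_finite: "i \<in> I \<Longrightarrow> finite (M i)"
  and M_subset: "i \<in> I \<Longrightarrow> M i \<subseteq> X"
  and X_eq: "X = (\<Union>i\<in>I. M i)"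
  and G_subgroup: "subgroup G (BijGroup (M e))"
  and pi_bij: "i \<in> I \<Longrightarrow> bij_betw (\<pi> i) (M e) (M i)"
  using data by (auto simp: B_data_def)

lemma M_nonempty:
  assumes "i \<in> I"
  shows "M i \<noteq> {}"
proof -
  obtain j where "j \<in> I" "M j \<noteq> {}"
    using X_nonempty X_eq by auto
  moreover have "card (M i) = card (M j)"
    using data assms \<open>j \<in> I\<close> unfolding B_data_def by blast
  ultimately show ?thesis
    using M_finite assms by fastforce
qed

lemma M_disjoint:
  assumes "i \<in> I" "j \<in> I" "x \<in> M i" "x \<in> M j"
  shows "i = j"
  using data assms by (auto simp: B_data_def disjoint_family_on_def)

lemma pi_in: "i \<in> I \<Longrightarrow> x \<in> M e \<Longrightarrow> \<pi> i x \<in> M i"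
  using pi_bij bij_betwE by blast

lemma M_cases:
  assumes "i \<in> I" "y \<in> M i"
  obtains x where "x \<in> M e" "y = \<pi> i x"
  using pi_bij[OF assms(1)] assms(2) by (metis bij_betw_imp_surj_on imageE)

lemma G_Bij: "G \<subseteq> Bij (M e)"
  using G_subgroup by (rule subgroup_BijGroupD)

lemma G_in: "g \<in> G \<Longrightarrow> x \<in> M e \<Longrightarrow> g x \<in> M e"
  by (rule Bij_mapsto[OF subsetD[OF G_Bij]])

lemma B_map_apply:
  assumes "i \<in> I" "x \<in> M e"
  shows "B_map e M \<pi> i g j (\<pi> i x) = Some (\<pi> j (g x))"
  using assms pi_in[OF assms] bij_betw_inv_into_left[OF pi_bij] by (simp add: B_map_def)

lemma ran_B_map:
  assumes "i \<in> I" "g \<in> G" "j \<in> I"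
  shows "ran (B_map e M \<pi> i g j) = M j"
proof -
  have "(\<pi> j \<circ> g \<circ> inv_into (M e) (\<pi> i)) ` M i = \<pi> j ` g ` inv_into (M e) (\<pi> i) ` M i"
    by (simp add: image_comp)
  also have "inv_into (M e) (\<pi> i) ` M i = M e"
    using pi_bij[OF assms(1)] bij_betw_def bij_betw_inv_into by metis
  also have "g ` M e = M e"
    using assms(2) G_Bij by (auto simp: Bij_def bij_betw_def)
  also have "\<pi> j ` M e = M j"
    using pi_bij[OF assms(3)] by (simp add: bij_betw_def)
  finally show ?thesis
    by (simp add: B_map_def)
qed

lemma B_map_eqI:
  assumes "i \<in> I" "dom f = M i" "\<And>x. x \<in> M e \<Longrightarrow> f (\<pi> i x) = Some (\<pi> j (g x))"
  shows "f = B_map e M \<pi> i g j"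
proof
  fix y
  show "f y = B_map e M \<pi> i g j y"
  proof (cases "y \<in> M i")
    case True
    then show ?thesis
      using assms M_cases B_map_apply by metis
  next
    case False
    then show ?thesis
      using assms(2) dom_B_map[of e M \<pi> i g j] by (metis domIff)
  qed
qed

lemma B_map_comp:
  assumes "i \<in> I" "j \<in> I" "g \<in> G"
  shows "B_map e M \<pi> j h k \<circ>\<^sub>m B_map e M \<pi> i g j = B_map e M \<pi> i (compose (M e) h g) k"
proof (rule B_map_eqI[OF assms(1)])
  have *: "(B_map e M \<pi> j h k \<circ>\<^sub>m B_map e M \<pi> i g j) (\<pi> i x) = Some (\<pi> k (compose (M e) h g x))"
    if "x \<in> M e" for x
    using that assms G_in by (simp add: B_map_apply compose_def map_comp_Some_iff)
  then show "(B_map e M \<pi> j h k \<circ>\<^sub>m B_map e M \<pi> i g j) (\<pi> i x) = Some (\<pi> k (compose (M e) h g x))"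
    if "x \<in> M e" for x
    using that .
  show "dom (B_map e M \<pi> j h k \<circ>\<^sub>m B_map e M \<pi> i g j) = M i"
  proof
    show "M i \<subseteq> dom (B_map e M \<pi> j h k \<circ>\<^sub>m B_map e M \<pi> i g j)"
      using * M_cases[OF assms(1)] by (metis domI subsetI)
    show "dom (B_map e M \<pi> j h k \<circ>\<^sub>m B_map e M \<pi> i g j) \<subseteq> M i"
    proof
      fix y assume "y \<in> dom (B_map e M \<pi> j h k \<circ>\<^sub>m B_map e M \<pi> i g j)"
      then have "y \<in> dom (B_map e M \<pi> i g j)"
        by (metis domD domI map_comp_Some_iff)
      then show "y \<in> M i"
        by (simp only: dom_B_map)
    qed
  qed
qed

lemma B_map_comp_empty:
  assumes "i \<in> I" "g \<in> G" "j \<in> I" "k \<in> I" "j \<noteq> k"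
  shows "B_map e M \<pi> k h l \<circ>\<^sub>m B_map e M \<pi> i g j = Map.empty"
proof -
  have "M j \<inter> M k = {}"
    using assms(5) M_disjoint[OF assms(3,4)] by (meson disjoint_iff)
  then have "ran (B_map e M \<pi> i g j) \<inter> dom (B_map e M \<pi> k h l) = {}"
    by (simp only: ran_B_map[OF assms(1-3)] dom_B_map)
  then have "ran (B_map e M \<pi> k h l \<circ>\<^sub>m B_map e M \<pi> i g j) = {}"
    by (simp add: ran_map_comp_eq)
  then show ?thesis
    by (rule ran_empty_imp)
qed

lemma B_map_inject:
  assumes "i \<in> I" "i' \<in> I" "j \<in> I" "j' \<in> I" "g \<in> G" "g' \<in> G"
    and eq: "B_map e M \<pi> i g j = B_map e M \<pi> i' g' j'"
  shows "i = i'" "g = g'" "j = j'"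
proof -
  have "M i = M i'" "M j = M j'"
    using eq assms dom_B_map ran_B_map by metis+
  then show ij: "i = i'" "j = j'"
    using M_nonempty M_disjoint assms by blast+
  show "g = g'"
  proof (rule extensionalityI)
    show "g \<in> extensional (M e)" "g' \<in> extensional (M e)"
      using assms G_Bij Bij_imp_extensional by blast+
    fix x assume x: "x \<in> M e"
    then have "\<pi> j (g x) = \<pi> j (g' x)"
      using B_map_apply[OF assms(1) x] eq ij by (metis option.inject)
    then show "g x = g' x"
      using pi_bij[OF assms(3)] x assms(5,6) G_in by (meson bij_betw_def inj_onD)
  qed
qed

lemma B_map_in_B: "i \<in> I \<Longrightarrow> g \<in> G \<Longrightarrow> j \<in> I \<Longrightarrow> B_map e M \<pi> i g j \<in> B I e G M \<pi>"
  unfolding B_def by blast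

lemma B_map_in_IS_fin:
  assumes "i \<in> I" "g \<in> G" "j \<in> I"
  shows "B_map e M \<pi> i g j \<in> IS_fin X"
proof -
  have "bij_betw g (M e) (M e)"
    using assms(2) G_Bij by (auto simp: Bij_def)
  then have "bij_betw (\<pi> j \<circ> g \<circ> inv_into (M e) (\<pi> i)) (M i) (M j)"
    using assms pi_bij by (meson bij_betw_inv_into bij_betw_trans)
  then show ?thesis
    unfolding B_map_def using assms M_finite M_subset
    by (intro as_partial_in_IS_fin) (auto simp: bij_betw_def)
qed

lemma subsemigroup_B: "subsemigroup (B I e G M \<pi>) (IS_fin X)"
  unfolding subsemigroup_def
proof (intro conjI ballI)
  show "B I e G M \<pi> \<noteq> {}"
    by (simp add: B_def)
  have "Map.empty \<in> IS_fin X"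
    by (simp add: IS_fin_def IS_def)
  then show "B I e G M \<pi> \<subseteq> IS_fin X"
    using B_map_in_IS_fin by (auto simp: B_def)
  fix f f' assume f: "f \<in> B I e G M \<pi>" "f' \<in> B I e G M \<pi>"
  show "f' \<circ>\<^sub>m f \<in> B I e G M \<pi>"
  proof (cases "f = Map.empty \<or> f' = Map.empty")
    case True
    then show ?thesis
      by (auto simp: B_def)
  next
    case False
    then obtain i g j k h l where f_eq: "f = B_map e M \<pi> i g j" "i \<in> I" "g \<in> G" "j \<in> I"
      and f'_eq: "f' = B_map e M \<pi> k h l" "k \<in> I" "h \<in> G" "l \<in> I"
      using f unfolding B_def by blast
    show ?thesis
    proof (cases "j = k")
      case True
      then have "f' \<circ>\<^sub>m f = B_map e M \<pi> i (compose (M e) h g) l"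
        using f_eq f'_eq by (simp add: B_map_comp)
      then show ?thesis
        using f_eq(2) f'_eq(4) subgroup_BijGroupD(3)[OF G_subgroup f'_eq(3) f_eq(3)]
        by (simp add: B_map_in_B)
    next
      case False
      then have "f' \<circ>\<^sub>m f = Map.empty"
        using B_map_comp_empty f_eq f'_eq by metis
      then show ?thesis
        by (simp add: B_def)
    qed
  qed
qed

lemma transitive_B:
  assumes "transitive_subgroup (M e) G"
  shows "transitive_on X (B I e G M \<pi>)"
  unfolding transitive_on_def
proof (intro ballI)
  fix x y assume "x \<in> X" "y \<in> X"
  then obtain i j where ij: "i \<in> I" "x \<in> M i" "j \<in> I" "y \<in> M j"
    using X_eq by auto
  then obtain x' y' where xy: "x' \<in> M e" "x = \<pi> i x'" "y' \<in> M e" "y = \<pi> j y'"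
    using M_cases by metis
  then obtain g where "g \<in> G" "g x' = y'"
    using assms by (auto simp: transitive_subgroup_iff)
  then have "B_map e M \<pi> i g j x = Some y"
    using ij xy by (simp add: B_map_apply)
  then show "\<exists>f\<in>B I e G M \<pi>. f x = Some y"
    using ij \<open>g \<in> G\<close> B_map_in_B by blast
qed

text \<open>A transitive subsemigroup of \<open>B\<close> meets every box \<open>{M(i,g,j) | g}\<close>. Its elements \<open>M(e,g,e)\<close>
  give a transitive subgroup of \<open>G\<close>, hence all of \<open>G\<close>, and multiplying by one element of a
  box on either side carries this over to all boxes.\<close>

lemma minimal_B:
  assumes min: "minimal_transitive_subgroup (M e) G"
  shows "minimal_transitive_subsemigroup X (IS_fin X) (B I e G M \<pi>)"
  unfolding minimal_transitive_subsemigroup_def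
proof (intro conjI allI impI)
  have trans: "transitive_subgroup (M e) G"
    using min by (simp add: minimal_transitive_subgroup_def)
  show "subsemigroup (B I e G M \<pi>) (IS_fin X)"
    by (rule subsemigroup_B)
  show "transitive_on X (B I e G M \<pi>)"
    using trans by (rule transitive_B)
  fix S assume S: "subsemigroup S (IS_fin X) \<and> transitive_on X S"
  show "\<not> S \<subset> B I e G M \<pi>"
  proof
    assume sub: "S \<subset> B I e G M \<pi>"
    note closed = subsemigroupD(3)[OF conjunct1[OF S]]
    \<comment> \<open>An element of \<open>B\<close> that maps a point of \<open>M i\<close> to a point of \<open>M j\<close> is some \<open>M(i,g,j)\<close>.\<close>
    have box: "\<exists>g\<in>G. B_map e M \<pi> i g j \<in> S \<and> g x = y"
      if ij: "i \<in> I" "j \<in> I" and xy: "x \<in> M e" "y \<in> M e" for i j x y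
    proof -
      have "\<pi> i x \<in> X" "\<pi> j y \<in> X"
        using pi_in M_subset ij xy by blast+
      then obtain f where f: "f \<in> S" "f (\<pi> i x) = Some (\<pi> j y)"
        using S by (auto simp: transitive_on_def)
      then obtain i' g j' where g: "f = B_map e M \<pi> i' g j'" "i' \<in> I" "g \<in> G" "j' \<in> I"
        using sub by (force simp: B_def)
      have "i' = i"
        using f(2) g(1,2) dom_B_map[of e M \<pi> i' g j'] ij(1) pi_in[OF ij(1) xy(1)] M_disjoint
        by (metis domI)
      have "j' = j"
        using f(2) g ran_B_map ij(2) pi_in[OF ij(2) xy(2)] M_disjoint by (metis ranI)
      have "\<pi> j (g x) = \<pi> j y"
        using f(2) g(1) \<open>i' = i\<close> \<open>j' = j\<close> B_map_apply[OF ij(1) xy(1)] by simp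
      then have "g x = y"
        using pi_bij[OF ij(2)] G_in[OF g(3) xy(1)] xy(2) by (meson bij_betw_def inj_onD)
      then show ?thesis
        using f(1) g \<open>i' = i\<close> \<open>j' = j\<close> by auto
    qed
    obtain a where a: "a \<in> M e"
      using M_nonempty e_in by blast
    define H where "H = {g \<in> G. B_map e M \<pi> e g e \<in> S}"
    have "transitive_subgroup (M e) H"
      unfolding transitive_subgroup_iff
    proof
      show "\<forall>x\<in>M e. \<forall>y\<in>M e. \<exists>g\<in>H. g x = y"
        using box[OF e_in e_in] by (fastforce simp: H_def)
      show "subgroup H (BijGroup (M e))"
      proof (rule subgroup_BijGroupI)
        show "H \<noteq> {}"
          using box[OF e_in e_in a a] by (auto simp: H_def)
        show "compose (M e) u v \<in> H" if "u \<in> H" "v \<in> H" for u v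
          using that closed[of "B_map e M \<pi> e v e" "B_map e M \<pi> e u e"]
            subgroup_BijGroupD(3)[OF G_subgroup] by (simp add: H_def B_map_comp e_in)
      qed (use M_finite e_in G_Bij in \<open>auto simp: H_def\<close>)
    qed
    then have HG: "H = G"
      using min by (auto simp: minimal_transitive_subgroup_def H_def)
    have all: "B_map e M \<pi> i g j \<in> S" if "i \<in> I" "g \<in> G" "j \<in> I" for i g j
    proof -
      obtain p where p: "p \<in> G" "B_map e M \<pi> i p e \<in> S"
        using box[OF \<open>i \<in> I\<close> e_in a a] by auto
      obtain q where q: "q \<in> G" "B_map e M \<pi> e q j \<in> S"
        using box[OF e_in \<open>j \<in> I\<close> a a] by auto
      \<comment> \<open>With functions composed from right to left, \<open>h = q\<^sup>-\<^sup>1 g p\<^sup>-\<^sup>1\<close>, so that \<open>M(i,g,j) = M(i,p,e) M(e,h,e) M(e,q,j)\<close>.\<close>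
      define p' q' where "p' = restrict (inv_into (M e) p) (M e)"
        and "q' = restrict (inv_into (M e) q) (M e)"
      define h where "h = compose (M e) q' (compose (M e) g p')"
      note comp = subgroup_BijGroupD(3)[OF G_subgroup]
      have "p' \<in> G" "q' \<in> G"
        unfolding p'_def q'_def using p(1) q(1) by (simp_all add: subgroup_BijGroupD(4)[OF G_subgroup])
      then have h: "h \<in> G"
        unfolding h_def using that(2) by (simp add: comp)
      then have "B_map e M \<pi> e h e \<in> S"
        using HG by (auto simp: H_def)
      from closed[OF p(2) this] have "B_map e M \<pi> i (compose (M e) h p) e \<in> S"
        by (simp add: B_map_comp \<open>i \<in> I\<close> e_in p(1))
      from closed[OF this q(2)]
      have "B_map e M \<pi> i (compose (M e) q (compose (M e) h p)) j \<in> S"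
        by (simp add: B_map_comp \<open>i \<in> I\<close> e_in comp[OF h p(1)])
      moreover have "compose (M e) q (compose (M e) h p) = g"
      proof (rule extensionalityI)
        show "g \<in> extensional (M e)"
          using that(2) G_Bij Bij_imp_extensional by blast
        fix x assume x: "x \<in> M e"
        have pq: "p \<in> Bij (M e)" "q \<in> Bij (M e)"
          using p q G_Bij by auto
        show "compose (M e) q (compose (M e) h p) x = g x"
          using x pq G_in[OF p(1) x] G_in[OF that(2) x]
          by (simp add: compose_def h_def p'_def q'_def Bij_inv_into_f Bij_f_inv_into)
      qed simp
      ultimately show ?thesis
        by simp
    qed
    have "Map.empty \<in> S"
    proof -
      obtain i j where ij: "i \<in> I" "j \<in> I" "i \<noteq> j"
        using data by (auto simp: B_data_def)
      then obtain g where "g \<in> G" "B_map e M \<pi> i g j \<in> S"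
        using box[OF ij(1,2) a a] by auto
      then show ?thesis
        using closed B_map_comp_empty[OF ij(1) _ ij(2) ij(1)] ij(3) by metis
    qed
    then have "B I e G M \<pi> \<subseteq> S"
      using all by (auto simp: B_def)
    then show False
      using sub by blast
  qed
qed

end


section \<open>The block system of a minimal transitive semigroup\<close>

lemma card_ran_comp_le:
  assumes "finite (ran f)"
  shows "card (ran (g \<circ>\<^sub>m f)) \<le> card (ran f \<inter> dom g)"
  using assms by (simp add: ran_map_comp_eq card_image_le)

lemma card_ran_comp_le_left:
  assumes "finite (ran f)"
  shows "card (ran (g \<circ>\<^sub>m f)) \<le> card (ran f)"
  using card_ran_comp_le[OF assms, of g] card_mono[OF assms, of "ran f \<inter> dom g"] by simp

lemma card_ran_comp_le_right:
  assumes "finite (ran g)"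
  shows "card (ran (g \<circ>\<^sub>m f)) \<le> card (ran g)"
  using assms by (intro card_mono) (auto simp: ran_def map_comp_Some_iff)

lemma transitive_onE:
  assumes "transitive_on X S" "x \<in> X" "y \<in> X"
  obtains f where "f \<in> S" "f x = Some y"
  using assms by (auto simp: transitive_on_def)

text \<open>The elements of least nonzero rank, together with the zero map if it is present, form a
  transitive ideal: to map \<open>x\<close> to \<open>y\<close>, take \<open>f0\<close> of least rank with \<open>a f0 = b\<close> and multiply it
  on both sides by elements that map \<open>x\<close> to \<open>a\<close> and \<open>b\<close> to \<open>y\<close>.\<close>

lemma minimal_imp_constant_rank:
  assumes min: "minimal_transitive_subsemigroup X (IS_fin X) S" and "X \<noteq> {}"
  obtains k where "\<And>f. f \<in> S \<Longrightarrow> f \<noteq> Map.empty \<Longrightarrow> card (ran f) = k"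
proof -
  have S: "subsemigroup S (IS_fin X)" and trans: "transitive_on X S"
    using min by (auto simp: minimal_transitive_subsemigroup_def)
  note closed = subsemigroupD(3)[OF S]
  have fin: "finite (ran f)" if "f \<in> S" for f
    using that subsemigroupD(2)[OF S] IS_finD(3) by blast
  obtain x where "x \<in> X"
    using assms(2) by auto
  then obtain f1 where "f1 \<in> S \<and> f1 \<noteq> Map.empty"
    using transitive_onE[OF trans, of x x] by (metis option.distinct(1))
  from ex_has_least_nat[of "\<lambda>f. f \<in> S \<and> f \<noteq> Map.empty", OF this, of "\<lambda>f. card (ran f)"]
  obtain f0 where f0: "f0 \<in> S" "f0 \<noteq> Map.empty"
    and least: "\<And>f. f \<in> S \<Longrightarrow> f \<noteq> Map.empty \<Longrightarrow> card (ran f0) \<le> card (ran f)"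
    by blast
  define J where "J = {f \<in> S. card (ran f) \<le> card (ran f0)}"
  have "J = S"
  proof (rule minimal_transitive_subsemigroupD[OF min])
    show "J \<subseteq> S" "J \<noteq> {}"
      using f0 by (auto simp: J_def)
    show "g \<circ>\<^sub>m f \<in> J" if "f \<in> J" "g \<in> J" for f g
      using that closed[of f g] card_ran_comp_le_left[OF fin, of f g] by (auto simp: J_def)
    show "transitive_on X J"
      unfolding transitive_on_def
    proof (intro ballI)
      fix x y assume xy: "x \<in> X" "y \<in> X"
      obtain a b where ab: "f0 a = Some b"
        using f0(2) by (meson ext not_None_eq)
      then have "a \<in> X" "b \<in> X"
        using f0(1) subsemigroupD(2)[OF S] IS_finD(1,2)[of f0 X] by (auto intro: ranI)
      then obtain s t where s: "s \<in> S" "s x = Some a" and t: "t \<in> S" "t b = Some y"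
        using transitive_onE[OF trans] xy by metis
      have "f0 \<circ>\<^sub>m s \<in> S"
        using closed s(1) f0(1) by blast
      then have "t \<circ>\<^sub>m (f0 \<circ>\<^sub>m s) \<in> S"
        using closed t(1) by blast
      moreover have "card (ran (t \<circ>\<^sub>m (f0 \<circ>\<^sub>m s))) \<le> card (ran f0)"
        using card_ran_comp_le_left[OF fin[OF \<open>f0 \<circ>\<^sub>m s \<in> S\<close>], of t]
          card_ran_comp_le_right[OF fin[OF f0(1)], of s] by simp
      moreover have "(t \<circ>\<^sub>m (f0 \<circ>\<^sub>m s)) x = Some y"
        using s(2) ab t(2) by simp
      ultimately show "\<exists>f\<in>J. f x = Some y"
        by (auto simp: J_def)
    qed
  qed
  then have "card (ran f) \<le> card (ran f0)" if "f \<in> S" for f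
    using that unfolding J_def by blast
  then have "card (ran f) = card (ran f0)" if "f \<in> S" "f \<noteq> Map.empty" for f
    using that least[OF that] by (simp add: le_antisym)
  then show ?thesis
    by (rule that)
qed

text \<open>Every nonempty domain or range of an element of \<open>S\<close> is the block \<open>bl x\<close> of each of its
  points \<open>x\<close>. If \<open>S\<close> is transitive on \<open>X\<close>, this makes the sets \<open>bl x\<close> with \<open>x \<in> X\<close> a partition
  of \<open>X\<close>; the values of \<open>bl\<close> outside \<open>X\<close> are irrelevant.\<close>

definition block_system :: "('a \<rightharpoonup> 'a) set \<Rightarrow> ('a \<Rightarrow> 'a set) \<Rightarrow> bool" where
  "block_system S bl \<longleftrightarrow>
     (\<forall>f\<in>S. (\<forall>x\<in>dom f. dom f = bl x) \<and> (\<forall>x\<in>ran f. ran f = bl x))"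

lemma minimal_imp_block_system:
  assumes min: "minimal_transitive_subsemigroup X (IS_fin X) S" and "X \<noteq> {}"
  obtains bl where "block_system S bl"
    and "\<And>x y. x \<in> X \<Longrightarrow> y \<in> X \<Longrightarrow> card (bl x) = card (bl y)"
proof -
  have S: "subsemigroup S (IS_fin X)" and trans: "transitive_on X S"
    using min by (auto simp: minimal_transitive_subsemigroup_def)
  obtain k where k: "\<And>f. f \<in> S \<Longrightarrow> f \<noteq> Map.empty \<Longrightarrow> card (ran f) = k"
    using minimal_imp_constant_rank[OF assms] by blast
  have S_IS: "f \<in> IS_fin X" if "f \<in> S" for f
    using that subsemigroupD(2)[OF S] by blast
  \<comment> \<open>A range that meets a domain equals it, as the product would otherwise have rank strictly
    between \<open>0\<close> and \<open>k\<close>.\<close>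
  have meet: "ran f = dom g" if fg: "f \<in> S" "g \<in> S" and z: "z \<in> ran f" "z \<in> dom g" for f g z
  proof -
    obtain y where y: "f y = Some z"
      using z(1) by (auto simp: ran_def)
    obtain t where "g z = Some t"
      using z(2) by blast
    with y have "(g \<circ>\<^sub>m f) y = Some t"
      by simp
    then have ne: "f \<noteq> Map.empty" "g \<noteq> Map.empty" "g \<circ>\<^sub>m f \<noteq> Map.empty"
      by auto
    have fin: "finite (ran f)" "finite (dom g)"
      using S_IS fg IS_finD(3,4) by blast+
    have "k \<le> card (ran f \<inter> dom g)"
      using card_ran_comp_le[OF fin(1), of g] k[OF subsemigroupD(3)[OF S fg] ne(3)] by simp
    moreover have "card (ran f) = k" "card (dom g) = k"
      using k fg ne IS_finD(5)[OF S_IS[OF fg(2)]] by simp_all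
    ultimately have "card (ran f) \<le> card (ran f \<inter> dom g)" "card (dom g) \<le> card (ran f \<inter> dom g)"
      by simp_all
    then have "ran f \<inter> dom g = ran f" "ran f \<inter> dom g = dom g"
      using card_seteq[OF fin(1) Int_lower1] card_seteq[OF fin(2) Int_lower2] by blast+
    then show ?thesis
      by simp
  qed
  \<comment> \<open>The block of \<open>x\<close> is the range of some element of \<open>S\<close> that fixes \<open>x\<close>.\<close>
  define u where "u x = (SOME f. f \<in> S \<and> f x = Some x)" for x
  have u: "u x \<in> S" "u x x = Some x" "x \<in> dom (u x)" "x \<in> ran (u x)" if "x \<in> X" for x
  proof -
    have "\<exists>f. f \<in> S \<and> f x = Some x"
      using transitive_onE[OF trans that that] by metis
    then have "u x \<in> S \<and> u x x = Some x"
      unfolding u_def by (rule someI_ex)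
    then show "u x \<in> S" "u x x = Some x" "x \<in> dom (u x)" "x \<in> ran (u x)"
      by (auto intro: ranI)
  qed
  show ?thesis
  proof
    have "dom f = ran (u x)" if "f \<in> S" "x \<in> dom f" for f x
    proof -
      have "x \<in> X"
        using that S_IS IS_finD(1) by blast
      then show ?thesis
        using meet[OF u(1) that(1) u(4) that(2)] by simp
    qed
    moreover have "ran f = ran (u x)" if "f \<in> S" "x \<in> ran f" for f x
    proof -
      have x: "x \<in> X"
        using that S_IS IS_finD(2) by blast
      have "ran f = dom (u x)"
        using meet[OF that(1) u(1) that(2) u(3)] x by simp
      also have "\<dots> = ran (u x)"
        using meet[OF u(1) u(1) u(4) u(3)] x by simp
      finally show ?thesis .
    qed
    ultimately show "block_system S (\<lambda>x. ran (u x))"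
      unfolding block_system_def by blast
    have "card (ran (u x)) = k" if "x \<in> X" for x
      using k[OF u(1)[OF that]] u(2)[OF that] by fastforce
    then show "card (ran (u x)) = card (ran (u y))" if "x \<in> X" "y \<in> X" for x y
      using that by simp
  qed
qed

context
  fixes X :: "'a set" and S and bl :: "'a \<Rightarrow> 'a set"
  assumes S: "subsemigroup S (IS_fin X)" and trans: "transitive_on X S"
    and blocks: "block_system S bl"
begin

lemma S_IS: "f \<in> S \<Longrightarrow> f \<in> IS_fin X"
  using subsemigroupD(2)[OF S] by blast

lemma dom_ran_bl:
  assumes "f \<in> S" "f x = Some y"
  shows "dom f = bl x" "ran f = bl y"
  using blocks assms(1) domI[of f, OF assms(2)] ranI[of f, OF assms(2)]
  by (simp_all add: block_system_def)

lemma bl_props: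
  assumes "x \<in> X"
  shows "x \<in> bl x" "bl x \<subseteq> X" "finite (bl x)" "y \<in> bl x \<Longrightarrow> bl y = bl x"
proof -
  obtain f where f: "f \<in> S" "f x = Some x"
    using transitive_onE[OF trans assms assms] .
  have eq: "dom f = bl x"
    using dom_ran_bl(1)[OF f] .
  show "x \<in> bl x" "bl x \<subseteq> X" "finite (bl x)"
    using f(2) eq IS_finD(1,4)[OF S_IS[OF f(1)]] by auto
  show "bl y = bl x" if "y \<in> bl x"
    using blocks f(1) that eq by (simp add: block_system_def)
qed

lemma transitive_perms_in:
  assumes "x \<in> X"
  shows "transitive_subgroup (bl x) (perms_in S (bl x))"
proof -
  have *: "\<exists>u\<in>perms_in S (bl x). u a = b" if "a \<in> bl x" "b \<in> bl x" for a b
  proof -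
    have "a \<in> X" "b \<in> X"
      using that bl_props(2)[OF assms] by auto
    then obtain f where f: "f \<in> S" "f a = Some b"
      using transitive_onE[OF trans] by metis
    then have "dom f = bl x" "ran f = bl x"
      using dom_ran_bl[OF f] bl_props(4)[OF assms] that by auto
    from perm_of_partial[OF S_IS[OF f(1)] this]
    obtain u where u: "u \<in> Bij (bl x)" "f = as_partial (bl x) u" .
    then show ?thesis
      using f that by (intro bexI[of _ u]) (auto simp: perms_in_def)
  qed
  then have "perms_in S (bl x) \<noteq> {}"
    using bl_props(1)[OF assms] by blast
  then show ?thesis
    using * subgroup_perms_in[OF S bl_props(3)[OF assms]] by (auto simp: transitive_subgroup_iff)
qed

text \<open>If \<open>f\<close> maps \<open>x\<close> to \<open>y\<close> and \<open>h \<in> S\<close> maps \<open>y\<close> back to \<open>x\<close>, then the product of \<open>f\<close> and \<open>h\<close>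
  is a permutation of the block of \<open>x\<close> and has an inverse in \<open>S\<close>; \<open>h\<close> followed by that inverse
  is the inverse of \<open>f\<close>.\<close>

lemma inverse_in_S:
  assumes f: "f \<in> S" "f \<noteq> Map.empty"
  obtains g where "g \<in> S" "dom g = ran f" "\<And>a b. f a = Some b \<Longrightarrow> g b = Some a"
proof -
  obtain x y where xy: "f x = Some y"
    using f(2) by (meson ext not_None_eq)
  have X: "x \<in> X" "y \<in> X"
    using xy IS_finD(1,2)[OF S_IS[OF f(1)]] by (auto intro: ranI)
  obtain h where h: "h \<in> S" "h y = Some x"
    using transitive_onE[OF trans X(2,1)] .
  have hf: "h \<circ>\<^sub>m f \<in> S" "(h \<circ>\<^sub>m f) x = Some x"
    using subsemigroupD(3)[OF S f(1) h(1)] xy h(2) by auto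
  obtain u where u: "u \<in> Bij (bl x)" "h \<circ>\<^sub>m f = as_partial (bl x) u"
    using perm_of_partial[OF S_IS[OF hf(1)] dom_ran_bl[OF hf]] .
  define v where "v = restrict (inv_into (bl x) u) (bl x)"
  have sub: "subgroup (perms_in S (bl x)) (BijGroup (bl x))"
    using transitive_perms_in[OF X(1)] by (simp add: transitive_subgroup_iff)
  have "u \<in> perms_in S (bl x)"
    using u hf(1) by (simp add: perms_in_def)
  then have "as_partial (bl x) v \<in> S"
    using subgroup_BijGroupD(4)[OF sub] by (auto simp: v_def perms_in_def)
  then have g: "as_partial (bl x) v \<circ>\<^sub>m h \<in> S"
    using subsemigroupD(3)[OF S h(1)] by blast
  have inverse: "(as_partial (bl x) v \<circ>\<^sub>m h) b = Some a" if "f a = Some b" for a b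
  proof -
    have a: "a \<in> bl x"
      using domI[of f, OF that] dom_ran_bl(1)[OF f(1) xy] by simp
    then have "(h \<circ>\<^sub>m f) a = Some (u a)"
      using u(2) by simp
    then have "h b = Some (u a)"
      using that by simp
    then show ?thesis
      using a u(1) by (simp add: v_def Bij_mapsto Bij_inv_into_f)
  qed
  show ?thesis
  proof
    show "dom (as_partial (bl x) v \<circ>\<^sub>m h) = ran f"
      using dom_ran_bl(1)[OF g inverse[OF xy]] dom_ran_bl(2)[OF f(1) xy] by simp
  qed (use g inverse in auto)
qed

end

section \<open>Classification\<close>

lemma transitive_group_semigroup:
  assumes "transitive_subgroup X K"
  shows "transitive_on X (as_partial X ` K)" "as_partial X ` K \<noteq> {}"
    and "f \<in> as_partial X ` K \<Longrightarrow> g \<in> as_partial X ` K \<Longrightarrow> g \<circ>\<^sub>m f \<in> as_partial X ` K"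
proof -
  have K: "subgroup K (BijGroup X)" and trans: "\<And>x y. x \<in> X \<Longrightarrow> y \<in> X \<Longrightarrow> \<exists>g\<in>K. g x = y"
    using assms by (auto simp: transitive_subgroup_iff)
  show "transitive_on X (as_partial X ` K)"
    unfolding transitive_on_def
  proof (intro ballI)
    fix x y assume "x \<in> X" "y \<in> X"
    moreover from this obtain g where "g \<in> K" "g x = y"
      using trans by metis
    ultimately show "\<exists>f\<in>as_partial X ` K. f x = Some y"
      by (intro bexI[of _ "as_partial X g"]) auto
  qed
  show "as_partial X ` K \<noteq> {}"
    using subgroup_BijGroupD(2)[OF K] by blast
  show "g \<circ>\<^sub>m f \<in> as_partial X ` K" if "f \<in> as_partial X ` K" "g \<in> as_partial X ` K"
  proof -
    from that obtain u v where uv: "u \<in> K" "f = as_partial X u" "v \<in> K" "g = as_partial X v"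
      by auto
    have "g \<circ>\<^sub>m f = as_partial X (compose X v u)"
      unfolding uv
      by (rule as_partial_compose[OF Bij_imp_funcset[OF subsetD[OF subgroup_BijGroupD(1)[OF K] uv(1)]]])
    then show ?thesis
      using subgroup_BijGroupD(3)[OF K uv(3,1)] by simp
  qed
qed

lemma minimal_group:
  assumes "finite X" and min: "minimal_transitive_subgroup X H" and "X \<noteq> {}"
  shows "minimal_transitive_subsemigroup X (IS_fin X) (as_partial X ` H)"
  unfolding minimal_transitive_subsemigroup_def
proof (intro conjI allI impI)
  have trans: "transitive_subgroup X H"
    using min by (simp add: minimal_transitive_subgroup_def)
  have HBij: "H \<subseteq> Bij X"
    using trans subgroup_BijGroupD(1) by (auto simp: transitive_subgroup_iff)
  have "as_partial X ` H \<subseteq> IS_fin X"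
    using HBij assms(1) by (auto simp: Bij_def bij_betw_def intro!: as_partial_in_IS_fin)
  then show "subsemigroup (as_partial X ` H) (IS_fin X)"
    using transitive_group_semigroup(2,3)[OF trans] by (simp add: subsemigroup_def)
  show "transitive_on X (as_partial X ` H)"
    by (rule transitive_group_semigroup(1)[OF trans])
  fix S assume S: "subsemigroup S (IS_fin X) \<and> transitive_on X S"
  show "\<not> S \<subset> as_partial X ` H"
  proof
    assume sub: "S \<subset> as_partial X ` H"
    have inj: "u \<in> H" if u: "u \<in> Bij X" "as_partial X u \<in> as_partial X ` H" for u
    proof -
      obtain v where v: "v \<in> H" "as_partial X u = as_partial X v"
        using u(2) by auto
      then have "u = v"
        using as_partial_inject[OF v(2)] u(1) HBij Bij_imp_extensional by blast
      then show ?thesis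
        using v(1) by simp
    qed
    have PH: "perms_in S X \<subseteq> H"
      using inj sub by (auto simp: perms_in_def)
    have *: "\<exists>u\<in>perms_in S X. u x = y" if xy: "x \<in> X" "y \<in> X" for x y
    proof -
      obtain f where f: "f \<in> S" "f x = Some y"
        using S transitive_onE[OF _ xy] by metis
      then obtain u where u: "u \<in> H" "f = as_partial X u"
        using sub by auto
      then have "u \<in> perms_in S X"
        using f HBij by (auto simp: perms_in_def)
      then show ?thesis
        using f u xy by auto
    qed
    then have "perms_in S X \<noteq> {}"
      using assms(3) by blast
    then have "transitive_subgroup X (perms_in S X)"
      using * subgroup_perms_in[OF conjunct1[OF S] assms(1)] by (auto simp: transitive_subgroup_iff)
    then have "perms_in S X = H"
      using min PH by (auto simp: minimal_transitive_subgroup_def)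
    then have "as_partial X ` H \<subseteq> S"
      by (auto simp: perms_in_def)
    then show False
      using sub by blast
  qed
qed

text \<open>The hypothesis on \<^term>\<open>perms_in S X\<close> covers the case of a single block.\<close>

lemma minimal_imp_group:
  assumes min: "minimal_transitive_subsemigroup X (IS_fin X) S"
    and trans: "transitive_subgroup X (perms_in S X)"
  shows "minimal_transitive_subgroup X (perms_in S X) \<and> S = as_partial X ` perms_in S X"
proof -
  have eq: "as_partial X ` K = S" if "K \<subseteq> perms_in S X" "transitive_subgroup X K" for K
    by (rule minimal_transitive_subsemigroupD[OF min])
      (use that transitive_group_semigroup[OF that(2)] in \<open>auto simp: perms_in_def\<close>)
  have "\<not> K \<subset> perms_in S X" if K: "transitive_subgroup X K" for K
  proof
    assume sub: "K \<subset> perms_in S X"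
    have "u \<in> K" if u: "u \<in> perms_in S X" for u
    proof -
      have "as_partial X u \<in> as_partial X ` K"
        using eq[of K] K sub u by (auto simp: perms_in_def)
      then obtain v where v: "v \<in> K" "as_partial X u = as_partial X v"
        by auto
      then have "u = v"
        using as_partial_inject[OF v(2)] u sub by (auto simp: perms_in_def Bij_imp_extensional)
      then show ?thesis
        using v(1) by simp
    qed
    then show False
      using sub by blast
  qed
  then show ?thesis
    using eq[OF _ trans] trans by (auto simp: minimal_transitive_subgroup_def)
qed

text \<open>The points \<open>x0\<close> and \<open>y0\<close> witness that there are at least two blocks. The index set is a set
  of representatives of the blocks, with \<open>M i = bl i\<close>.\<close>

lemma minimal_imp_B:
  fixes X :: "'a set" and bl :: "'a \<Rightarrow> 'a set"
  assumes min: "minimal_transitive_subsemigroup X (IS_fin X) S"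
    and bl: "block_system S bl"
    and card_bl: "\<And>x y. x \<in> X \<Longrightarrow> y \<in> X \<Longrightarrow> card (bl x) = card (bl y)"
    and x0: "x0 \<in> X" and y0: "y0 \<in> X" "bl y0 \<noteq> bl x0"
  shows "\<exists>(I :: 'a set) e G M \<pi>. B_data X I e G M \<pi> \<and> minimal_transitive_subgroup (M e) G \<and>
    S = B I e G M \<pi>"
proof -
  have S: "subsemigroup S (IS_fin X)" and trans: "transitive_on X S"
    using min by (auto simp: minimal_transitive_subsemigroup_def)
  note closed = subsemigroupD(3)[OF S]
  note blocks = S trans bl
  note S_IS = S_IS[OF blocks]
  note dom_ran_bl = dom_ran_bl[OF blocks]
  note bl_props = bl_props[OF blocks]
  have X_ne: "X \<noteq> {}"
    using x0 by auto
  define rep where "rep x = (SOME y. y \<in> bl x)" for x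
  have rep: "rep x \<in> bl x" "rep x \<in> X" "bl (rep x) = bl x" if "x \<in> X" for x
  proof -
    show 1: "rep x \<in> bl x"
      unfolding rep_def using bl_props(1)[OF that] by (rule someI)
    show "rep x \<in> X" "bl (rep x) = bl x"
      using 1 bl_props(2,4)[OF that] by auto
  qed
  have rep_eq: "rep x = rep y" if "bl x = bl y" for x y
    using that by (simp add: rep_def)
  define I where "I = rep ` X"
  define e where "e = rep x0"
  define G where "G = perms_in S (bl e)"
  have I_X: "i \<in> X" if "i \<in> I" for i
    using that rep(2) by (auto simp: I_def)
  have I_inj: "i = j" if ij: "i \<in> I" "j \<in> I" "bl i = bl j" for i j
  proof -
    obtain x y where xy: "x \<in> X" "y \<in> X" "i = rep x" "j = rep y"
      using ij(1,2) by (auto simp: I_def)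
    then have "bl x = bl y"
      using ij(3) rep(3) by simp
    then show ?thesis
      using xy(3,4) rep_eq[of x y] by simp
  qed
  have e: "e \<in> I" "e \<in> X"
    using x0 rep(2) by (auto simp: e_def I_def)
  have ex_p: "\<exists>f. f \<in> S \<and> f e = Some i" if "i \<in> I" for i
    using transitive_onE[OF trans e(2) I_X[OF that]] by metis
  \<comment> \<open>\<open>p i\<close> is an element of \<open>S\<close> with domain \<open>bl e\<close> and range \<open>bl i\<close>, and \<open>\<pi> i\<close> is the
    corresponding total function.\<close>
  define p where "p i = (SOME f. f \<in> S \<and> f e = Some i)" for i
  have p: "p i \<in> S" "p i e = Some i" if "i \<in> I" for i
    using someI_ex[OF ex_p[OF that]] by (auto simp: p_def)
  have dom_p: "dom (p i) = bl e" and ran_p: "ran (p i) = bl i" if "i \<in> I" for i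
    using dom_ran_bl[OF p[OF that]] by auto
  define \<pi> where "\<pi> i x = the (p i x)" for i x
  have p_apply: "p i x = Some (\<pi> i x)" if "i \<in> I" "x \<in> bl e" for i x
  proof -
    have "x \<in> dom (p i)"
      using that dom_p by simp
    then show ?thesis
      by (auto simp: \<pi>_def)
  qed
  have ex_q: "\<exists>q. q \<in> S \<and> dom q = bl i \<and> (\<forall>x\<in>bl e. q (\<pi> i x) = Some x)" if "i \<in> I" for i
  proof -
    have "p i \<noteq> Map.empty"
      using p(2)[OF that] by auto
    from inverse_in_S[OF blocks p(1)[OF that] this] obtain q
      where "q \<in> S" "dom q = ran (p i)" "\<And>a b. p i a = Some b \<Longrightarrow> q b = Some a"
      by blast
    then show ?thesis
      using ran_p[OF that] p_apply[OF that] by blast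
  qed
  have data: "B_data X I e K bl \<pi>" if "subgroup K (BijGroup (bl e))" for K
    unfolding B_data_def
  proof (intro conjI ballI that)
    show "e \<in> I"
      by (rule e)
    have "rep x0 \<noteq> rep y0"
      using rep(3) x0 y0 by metis
    then show "\<exists>i\<in>I. \<exists>j\<in>I. i \<noteq> j"
      using x0 y0 by (auto simp: I_def)
    show "disjoint_family_on bl I"
      unfolding disjoint_family_on_def
    proof (intro ballI impI)
      fix i j assume ij: "i \<in> I" "j \<in> I" "i \<noteq> j"
      show "bl i \<inter> bl j = {}"
      proof (rule ccontr)
        assume "bl i \<inter> bl j \<noteq> {}"
        then obtain z where "z \<in> bl i" "z \<in> bl j"
          by auto
        then have "bl i = bl j"
          using bl_props(4)[OF I_X] ij by metis
        then show False
          using I_inj ij by blast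
      qed
    qed
    show "X = (\<Union>i\<in>I. bl i)"
    proof
      show "X \<subseteq> (\<Union>i\<in>I. bl i)"
        using bl_props(1) rep(3) by (auto simp: I_def)
      show "(\<Union>i\<in>I. bl i) \<subseteq> X"
        using bl_props(2) I_X by blast
    qed
    show "finite (bl i)" if "i \<in> I" for i
      using bl_props(3)[OF I_X[OF that]] .
    show "card (bl i) = card (bl j)" if "i \<in> I" "j \<in> I" for i j
      using card_bl I_X that by blast
    show "bij_betw (\<pi> i) (bl e) (bl i)" if "i \<in> I" for i
      using IS_fin_bij[OF S_IS[OF p(1)[OF that]]] dom_p[OF that] ran_p[OF that]
      by (simp add: \<pi>_def[abs_def])
  qed
  have trans_G: "transitive_subgroup (bl e) G"
    unfolding G_def using e(2) by (rule transitive_perms_in[OF blocks])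
  then have data_G: "B_data X I e G bl \<pi>"
    by (intro data) (simp add: transitive_subgroup_iff)
  note pi_in = pi_in[OF data_G X_ne] and G_in = G_in[OF data_G X_ne]

  have B_sub: "B I e G bl \<pi> \<subseteq> S"
  proof
    fix f assume "f \<in> B I e G bl \<pi>"
    then consider "f = Map.empty"
      | i g j where "i \<in> I" "g \<in> G" "j \<in> I" "f = B_map e bl \<pi> i g j"
      unfolding B_def by blast
    then show "f \<in> S"
    proof cases
      case 1
      \<comment> \<open>The zero map is the square of any element that leads from one block to another.\<close>
      obtain h where h: "h \<in> S" "h x0 = Some y0"
        using transitive_onE[OF trans x0 y0(1)] .
      have "(h \<circ>\<^sub>m h) z = None" for z
      proof (rule ccontr)
        assume "(h \<circ>\<^sub>m h) z \<noteq> None"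
        then obtain w t where w: "h z = Some w" "h w = Some t"
          by (auto simp: map_comp_Some_iff)
        have "bl x0 = bl w" "bl y0 = bl w"
          using dom_ran_bl[OF h] dom_ran_bl(2)[OF h(1) w(1)] dom_ran_bl(1)[OF h(1) w(2)] by auto
        then show False
          using y0(2) by simp
      qed
      then have "h \<circ>\<^sub>m h = f"
        using 1 by auto
      then show ?thesis
        using closed[OF h(1) h(1)] by simp
    next
      case 2
      obtain q where q: "q \<in> S" "\<And>x. x \<in> bl e \<Longrightarrow> q (\<pi> i x) = Some x"
        using ex_q[OF 2(1)] by metis
      let ?h = "p j \<circ>\<^sub>m (as_partial (bl e) g \<circ>\<^sub>m q)"
      have "as_partial (bl e) g \<in> S"
        using 2(2) by (simp add: G_def perms_in_def)
      then have h: "?h \<in> S"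
        using closed[OF closed[OF q(1)] p(1)[OF 2(3)]] by blast
      have app: "?h (\<pi> i x) = Some (\<pi> j (g x))" if "x \<in> bl e" for x
        using that q(2)[OF that] p_apply[OF 2(3) G_in[OF 2(2) that]] by simp
      have "\<pi> i e \<in> bl i"
        using pi_in[OF 2(1)] bl_props(1)[OF e(2)] by simp
      then have "dom ?h = bl i"
        using dom_ran_bl(1)[OF h app[OF bl_props(1)[OF e(2)]]] bl_props(4)[OF I_X[OF 2(1)]] by simp
      then have "?h = f"
        unfolding 2(4) using app by (rule B_map_eqI[OF data_G X_ne 2(1)])
      then show ?thesis
        using h by simp
    qed
  qed

  have S_sub: "S \<subseteq> B I e G bl \<pi>"
  proof
    fix f assume f: "f \<in> S"
    show "f \<in> B I e G bl \<pi>"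
    proof (cases "f = Map.empty")
      case True
      then show ?thesis
        by (simp add: B_def)
    next
      case False
      then obtain x y where xy: "f x = Some y"
        by (meson ext not_None_eq)
      then have X: "x \<in> X" "y \<in> X"
        using IS_finD(1,2)[OF S_IS[OF f]] by (auto intro: ranI)
      define i j where "i = rep x" and "j = rep y"
      have ij: "i \<in> I" "j \<in> I"
        using X by (auto simp: i_def j_def I_def)
      have df: "dom f = bl i" and rf: "ran f = bl j"
        using dom_ran_bl[OF f xy] rep(3) X by (auto simp: i_def j_def)
      obtain q where q: "q \<in> S" "\<And>x. x \<in> bl e \<Longrightarrow> q (\<pi> j x) = Some x"
        using ex_q[OF ij(2)] by metis
      \<comment> \<open>The product \<open>\<pi>\<^sub>i f \<pi>\<^sub>j\<^sup>-\<^sup>1\<close> belongs to \<open>G\<close> and is the middle entry of \<open>f\<close>.\<close>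
      let ?w = "q \<circ>\<^sub>m (f \<circ>\<^sub>m p i)"
      have w: "?w \<in> S"
        using closed[OF closed[OF p(1)[OF ij(1)] f] q(1)] .
      have step: "\<exists>s\<in>bl e. f (\<pi> i z) = Some (\<pi> j s) \<and> ?w z = Some s" if z: "z \<in> bl e" for z
      proof -
        obtain t where t: "f (\<pi> i z) = Some t"
          using pi_in[OF ij(1) z] df by auto
        then have "t \<in> bl j"
          using rf by (metis ranI)
        then obtain s where s: "s \<in> bl e" "t = \<pi> j s"
          using M_cases[OF data_G X_ne ij(2)] by metis
        then show ?thesis
          using t q(2) p_apply[OF ij(1) z] by auto
      qed
      obtain s where s: "s \<in> bl e" "?w e = Some s"
        using step[OF bl_props(1)[OF e(2)]] by blast
      have "dom ?w = bl e" "ran ?w = bl e"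
        using dom_ran_bl[OF w s(2)] bl_props(4)[OF e(2) s(1)] by auto
      from perm_of_partial[OF S_IS[OF w] this]
      obtain u where u: "u \<in> Bij (bl e)" "?w = as_partial (bl e) u" .
      have "u \<in> G"
        using u w by (simp add: G_def perms_in_def)
      have "f = B_map e bl \<pi> i u j"
      proof (rule B_map_eqI[OF data_G X_ne ij(1) df])
        fix z assume z: "z \<in> bl e"
        obtain s where "f (\<pi> i z) = Some (\<pi> j s)" "?w z = Some s"
          using step[OF z] by blast
        then show "f (\<pi> i z) = Some (\<pi> j (u z))"
          using u(2) z by simp
      qed
      then show ?thesis
        using B_map_in_B[OF data_G X_ne ij(1) \<open>u \<in> G\<close> ij(2)] by simp
    qed
  qed

  have "\<not> H \<subset> G" if H: "transitive_subgroup (bl e) H" for H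
  proof
    assume HG: "H \<subset> G"
    have data_H: "B_data X I e H bl \<pi>"
      using H by (intro data) (simp add: transitive_subgroup_iff)
    note subH = subsemigroup_B[OF data_H X_ne]
    have "B I e H bl \<pi> \<subseteq> S"
      using B_sub HG unfolding B_def by blast
    then have eq: "B I e H bl \<pi> = S"
      using minimal_transitive_subsemigroupD[OF min _ subsemigroupD(1)[OF subH]
          transitive_B[OF data_H X_ne H] subsemigroupD(3)[OF subH]] by blast
    have "g \<in> H" if g: "g \<in> G" for g
    proof -
      have "B_map e bl \<pi> e g e \<in> B I e H bl \<pi>"
        unfolding eq using B_sub B_map_in_B[OF data_G X_ne e(1) g e(1)] by blast
      moreover have "B_map e bl \<pi> e g e \<noteq> Map.empty"
        using dom_B_map[of e bl \<pi> e g e] bl_props(1)[OF e(2)] by (metis dom_empty empty_iff)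
      ultimately obtain i h j where h: "i \<in> I" "h \<in> H" "j \<in> I"
        "B_map e bl \<pi> e g e = B_map e bl \<pi> i h j"
        unfolding B_def by blast
      then have "g = h"
        using B_map_inject(2)[OF data_G X_ne e(1) h(1) e(1) h(3) g _ h(4)] HG by blast
      then show ?thesis
        using h(2) by simp
    qed
    then show False
      using HG by blast
  qed
  then have "minimal_transitive_subgroup (bl e) G"
    using trans_G by (simp add: minimal_transitive_subgroup_def)
  moreover have "S = B I e G bl \<pi>"
    using B_sub S_sub by blast
  ultimately show ?thesis
    using data_G by blast
qed

lemma minimal_classification:
  fixes X :: "'a set"
  assumes "X \<noteq> {}" and min: "minimal_transitive_subsemigroup X (IS_fin X) S"
  shows "(\<exists>(I :: 'a set) e G M \<pi>. B_data X I e G M \<pi> \<and> minimal_transitive_subgroup (M e) G \<and>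
      S = B I e G M \<pi>) \<or>
    finite X \<and> (\<exists>H. minimal_transitive_subgroup X H \<and> S = as_partial X ` H)"
proof -
  have S: "subsemigroup S (IS_fin X)" and trans: "transitive_on X S"
    using min by (auto simp: minimal_transitive_subsemigroup_def)
  obtain bl where bl: "block_system S bl"
    and card_bl: "\<And>x y. x \<in> X \<Longrightarrow> y \<in> X \<Longrightarrow> card (bl x) = card (bl y)"
    using minimal_imp_block_system[OF min assms(1)] by metis
  note blocks = S trans bl
  obtain x0 where x0: "x0 \<in> X"
    using assms(1) by auto
  show ?thesis
  proof (cases "\<exists>y\<in>X. bl y \<noteq> bl x0")
    case True
    then obtain y0 where "y0 \<in> X" "bl y0 \<noteq> bl x0"
      by auto
    with minimal_imp_B[OF min bl card_bl x0] show ?thesis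
      by simp
  next
    case False
    then have "bl x0 = X"
      using bl_props(1,2)[OF blocks] x0 by blast
    then have "finite X" "transitive_subgroup X (perms_in S X)"
      using bl_props(3)[OF blocks x0] transitive_perms_in[OF blocks x0] by auto
    then show ?thesis
      using minimal_imp_group[OF min] by blast
  qed
qed

theorem theorem2p8:
  fixes X :: "'a set"
  assumes "X \<noteq> {}"
  shows
    "(infinite X \<longrightarrow>
       (\<forall>S. minimal_transitive_subsemigroup X (IS_fin X) S \<longleftrightarrow>
           (\<exists>(I :: 'a set) e G M \<pi>. B_data X I e G M \<pi> \<and>
              minimal_transitive_subgroup (M e) G \<and> S = B I e G M \<pi>)) \<and>
       (\<forall>(I :: 'i set) e G M \<pi>. B_data X I e G M \<pi> \<and> minimal_transitive_subgroup (M e) G \<longrightarrow>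
          minimal_transitive_subsemigroup X (IS_fin X) (B I e G M \<pi>))) \<and>
     (finite X \<longrightarrow>
       (\<forall>S. minimal_transitive_subsemigroup X (IS X) S \<longleftrightarrow>
           (\<exists>(I :: 'a set) e G M \<pi>. B_data X I e G M \<pi> \<and>
              minimal_transitive_subgroup (M e) G \<and> S = B I e G M \<pi>) \<or>
           (\<exists>H. minimal_transitive_subgroup X H \<and> S = as_partial X ` H)) \<and>
       (\<forall>(I :: 'i set) e G M \<pi>. B_data X I e G M \<pi> \<and> minimal_transitive_subgroup (M e) G \<longrightarrow>
          minimal_transitive_subsemigroup X (IS X) (B I e G M \<pi>)))"
proof (intro conjI impI allI)
  fix S assume inf: "infinite X"
  show "minimal_transitive_subsemigroup X (IS_fin X) S \<longleftrightarrow>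
    (\<exists>(I :: 'a set) e G M \<pi>. B_data X I e G M \<pi> \<and> minimal_transitive_subgroup (M e) G \<and>
      S = B I e G M \<pi>)" (is "_ \<longleftrightarrow> ?B")
  proof
    assume "minimal_transitive_subsemigroup X (IS_fin X) S"
    from minimal_classification[OF assms this] inf show ?B
      by simp
  qed (use minimal_B[OF _ assms] in auto)
next
  fix S assume fin: "finite X"
  show "minimal_transitive_subsemigroup X (IS X) S \<longleftrightarrow>
    (\<exists>(I :: 'a set) e G M \<pi>. B_data X I e G M \<pi> \<and> minimal_transitive_subgroup (M e) G \<and>
      S = B I e G M \<pi>) \<or>
    (\<exists>H. minimal_transitive_subgroup X H \<and> S = as_partial X ` H)" (is "_ \<longleftrightarrow> ?B \<or> ?H")
  proof
    assume "minimal_transitive_subsemigroup X (IS X) S"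
    then have "minimal_transitive_subsemigroup X (IS_fin X) S"
      by (simp add: IS_fin_eq_IS[OF fin])
    from minimal_classification[OF assms this] fin show "?B \<or> ?H"
      by simp
  next
    assume "?B \<or> ?H"
    then have "minimal_transitive_subsemigroup X (IS_fin X) S"
      using minimal_B[OF _ assms] minimal_group[OF fin _ assms] by auto
    then show "minimal_transitive_subsemigroup X (IS X) S"
      by (simp add: IS_fin_eq_IS[OF fin])
  qed
qed (use minimal_B[OF _ assms] IS_fin_eq_IS[of X] in auto)

end
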